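(* For integers $k_1\le k_2\le N-2$, $$W_1(N,k_1,k_2)=\theta^2P_{N-2}\,W_1(N-1,k_1,k_2)+\theta\,T_1(N-1,k_1,k_2)+\sum_{i=k_1+1}^{k_2+1}\theta^{N-i-1}T_1(i-1,k_1)B(i-1,N-i-1)(P_{N-i-1})!$$ $$+\sum_{i=k_2+2}^{N-1}\theta^{N-i-1}T_1(i-1,k_1,k_2)B(i-1,N-i-1)(P_{N-i-1})!.$$
   Context: Let $\theta>0$ and $k_1\ge0$. $\mathrm{inv}(\pi)$ is the number of pairs $i<j$ with $\pi_i>\pi_j$. $P_n=1+\theta+\cdots+\theta^{n-1}$, $(P_n)!=P_n\cdots P_1$, $(P_0)!=1$. $B(n,m)=\sum\theta^{\#\{(a,b):a\in\Pi_1,b\in\Pi_2,a>b\}}$ over ordered partitions $(\Pi_1,\Pi_2)$ of $\{1,\dots,n+m\}$ with $|\Pi_1|=n,|\Pi_2|=m$. For $\pi\in S_n$, position $i$ is a left-to-right maximum if $\pi_i>\pi_j$ for all $j<i$, and a left-to-right second maximum if exactly one $j<i$ has $\pi_j>\pi_i$. $\pi$ is $k$-pickable if some position $i>k$ is a left-to-right maximum; $T_1(n,k)=\sum_{\pi\in S_n\text{ not }k\text{-pickable}}\theta^{\mathrm{inv}(\pi)}$. The $(k_1,k_2)$-strategy accepts the first position $i$ such that either $i>k_1$ and $i$ is a left-to-right maximum, or $i>k_2$ and $i$ is a left-to-right second maximum (if there is none, the last position is accepted). $\pi\in S_n$ is $(k_1,k_2)$-pickable if this rule selects some position, and $(k_1,k_2)$-winnable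 if the accepted position holds value $n-1$. $T_1(n,k_1,k_2)=\sum_{\text{not }(k_1,k_2)\text{-pickable}}\theta^{\mathrm{inv}(\pi)}$, $W_1(n,k_1,k_2)=\sum_{(k_1,k_2)\text{-winnable}}\theta^{\mathrm{inv}(\pi)}$. *)

theory Defs
  imports Complex_Main "HOL-Combinatorics.Permutations"
begin

definition inversions :: "nat \<Rightarrow> (nat \<Rightarrow> nat) \<Rightarrow> nat" where
  "inversions n p = card {(i, j). 1 \<le> i \<and> i < j \<and> j \<le> n \<and> p i > p j}"

definition P :: "real \<Rightarrow> nat \<Rightarrow> real" where
  "P \<theta> n = (\<Sum>i<n. \<theta> ^ i)"

definition P_fact :: "real \<Rightarrow> nat \<Rightarrow> real" where
  "P_fact \<theta> n = (\<Prod>i=1..n. P \<theta> i)"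

definition B :: "real \<Rightarrow> nat \<Rightarrow> nat \<Rightarrow> real" where
  "B \<theta> n m =
     (\<Sum>(X, Y) \<in> {(X, Y). X \<union> Y = {1..n + m} \<and> X \<inter> Y = {} \<and> card X = n \<and> card Y = m}.
        \<theta> ^ card {(a, b). a \<in> X \<and> b \<in> Y \<and> a > b})"

definition ltr_max :: "(nat \<Rightarrow> nat) \<Rightarrow> nat \<Rightarrow> bool" where
  "ltr_max p i \<longleftrightarrow> (\<forall>j\<in>{1..<i}. p i > p j)"

definition ltr_second_max :: "(nat \<Rightarrow> nat) \<Rightarrow> nat \<Rightarrow> bool" where
  "ltr_second_max p i \<longleftrightarrow> (\<exists>!j. j \<in> {1..<i} \<and> p j > p i)"

definition pickable1 :: "nat \<Rightarrow> nat \<Rightarrow> (nat \<Rightarrow> nat) \<Rightarrow> bool" where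
  "pickable1 n k p \<longleftrightarrow> (\<exists>i\<in>{1..n}. i > k \<and> ltr_max p i)"

definition eligible :: "nat \<Rightarrow> nat \<Rightarrow> (nat \<Rightarrow> nat) \<Rightarrow> nat \<Rightarrow> bool" where
  "eligible k1 k2 p i \<longleftrightarrow> (i > k1 \<and> ltr_max p i) \<or> (i > k2 \<and> ltr_second_max p i)"

definition pickable2 :: "nat \<Rightarrow> nat \<Rightarrow> nat \<Rightarrow> (nat \<Rightarrow> nat) \<Rightarrow> bool" where
  "pickable2 n k1 k2 p \<longleftrightarrow> (\<exists>i\<in>{1..n}. eligible k1 k2 p i)"

definition accepted :: "nat \<Rightarrow> nat \<Rightarrow> nat \<Rightarrow> (nat \<Rightarrow> nat) \<Rightarrow> nat" where
  "accepted n k1 k2 p =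
     (if pickable2 n k1 k2 p then LEAST i. i \<in> {1..n} \<and> eligible k1 k2 p i else n)"

(* Suc on the left rather than n - 1 on the right: no truncation at n = 0. *)
definition winnable :: "nat \<Rightarrow> nat \<Rightarrow> nat \<Rightarrow> (nat \<Rightarrow> nat) \<Rightarrow> bool" where
  "winnable n k1 k2 p \<longleftrightarrow> Suc (p (accepted n k1 k2 p)) = n"

(* T1_one is T_1(n, k) and T1_two is T_1(n, k1, k2). *)
definition T1_one :: "real \<Rightarrow> nat \<Rightarrow> nat \<Rightarrow> real" where
  "T1_one \<theta> n k =
     (\<Sum>p \<in> {p. p permutes {1..n} \<and> \<not> pickable1 n k p}. \<theta> ^ inversions n p)"

definition T1_two :: "real \<Rightarrow> nat \<Rightarrow> nat \<Rightarrow> nat \<Rightarrow> real" where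
  "T1_two \<theta> n k1 k2 =
     (\<Sum>p \<in> {p. p permutes {1..n} \<and> \<not> pickable2 n k1 k2 p}. \<theta> ^ inversions n p)"

definition W1 :: "real \<Rightarrow> nat \<Rightarrow> nat \<Rightarrow> nat \<Rightarrow> real" where
  "W1 \<theta> n k1 k2 =
     (\<Sum>p \<in> {p. p permutes {1..n} \<and> winnable n k1 k2 p}. \<theta> ^ inversions n p)"

end

theory Submission
  imports Defs
begin

text \<open>Condition on the last value \<open>v\<close> of a permutation of \<open>{1..N}\<close>. Deleting it and
  standardising removes \<open>N - v\<close> inversions and does not change which of the positions
  \<open>1..N-1\<close> are eligible. The values \<open>v \<le> N - 2\<close> give the first summand, \<open>v = N - 1\<close> the
  second. If \<open>v = N\<close>, the permutation is winnable iff the value \<open>N - 1\<close> stands at a position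
  \<open>i > k1\<close> such that no position before \<open>i\<close> is eligible. Deleting last entries repeatedly
  reduces the sum over these permutations, up to a power of \<open>\<theta>\<close>, to \<open>T\<^sub>1(i - 1, \<dots>)\<close> times \<open>P\<^sub>i \<cdots> P\<^bsub>N-2\<^esub>\<close>, and this
  product is \<open>B(i - 1, N - i - 1) (P\<^bsub>N-i-1\<^esub>)!\<close> because \<open>B\<close> is a Gaussian binomial
  coefficient.\<close>

section \<open>The Gaussian binomial coefficient\<close>

definition cross_inversions :: "nat \<Rightarrow> nat set \<Rightarrow> nat" where
  "cross_inversions s X = card {(a, b). a \<in> X \<and> b \<in> {1..s} - X \<and> a > b}"

text \<open>The Gaussian binomial coefficient at \<open>\<theta>\<close>, as a generating function
  of subsets. The size s of the ground set is the parameter, since the Pascal rule recurses on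
  it.\<close>

definition gauss_binomial :: "real \<Rightarrow> nat \<Rightarrow> nat \<Rightarrow> real" where
  "gauss_binomial \<theta> s n =
     (\<Sum>X \<in> {X. X \<subseteq> {1..s} \<and> card X = n}. \<theta> ^ cross_inversions s X)"

lemma B_eq_gauss_binomial: "B \<theta> n m = gauss_binomial \<theta> (n + m) n"
  unfolding B_def gauss_binomial_def cross_inversions_def
proof (rule sum.reindex_bij_witness[where i = "\<lambda>X. (X, {1..n + m} - X)" and j = fst])
  fix Z assume "Z \<in> {(X, Y). X \<union> Y = {1..n + m} \<and> X \<inter> Y = {} \<and> card X = n \<and> card Y = m}"
  then obtain X Y where Z: "Z = (X, Y)" "X \<union> Y = {1..n + m}" "X \<inter> Y = {}" "card X = n"
    by auto
  then have Y: "Y = {1..n + m} - X" by blast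
  show "(fst Z, {1..n + m} - fst Z) = Z" using Z Y by simp
  show "fst Z \<in> {X. X \<subseteq> {1..n + m} \<and> card X = n}" using Z by auto
  show "\<theta> ^ card {(a, b). a \<in> fst Z \<and> b \<in> {1..n + m} - fst Z \<and> b < a} =
      (case Z of (X, Y) \<Rightarrow> \<theta> ^ card {(a, b). a \<in> X \<and> b \<in> Y \<and> b < a})"
    unfolding Z(1) Y by simp
next
  fix X assume X: "X \<in> {X. X \<subseteq> {1..n + m} \<and> card X = n}"
  then have "card ({1..n + m} - X) = m"
    using card_Diff_subset[of X "{1..n + m}"] finite_subset[of X "{1..n + m}"] by simp
  with X show "(X, {1..n + m} - X) \<in>
      {(X, Y). X \<union> Y = {1..n + m} \<and> X \<inter> Y = {} \<and> card X = n \<and> card Y = m}"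
    by auto
qed simp

lemma cross_inversions_Suc:
  assumes "X \<subseteq> {1..s}"
  shows "cross_inversions (Suc s) X = cross_inversions s X"
proof -
  have "{(a, b). a \<in> X \<and> b \<in> {1..Suc s} - X \<and> a > b} = {(a, b). a \<in> X \<and> b \<in> {1..s} - X \<and> a > b}"
    using assms by fastforce
  then show ?thesis unfolding cross_inversions_def by simp
qed

text \<open>The new largest element exceeds every element of the complement and so adds one pair for
  each.\<close>

lemma cross_inversions_insert_Suc:
  assumes "X \<subseteq> {1..s}"
  shows "cross_inversions (Suc s) (insert (Suc s) X) = cross_inversions s X + (s - card X)"
proof -
  have fin: "finite X" using assms finite_subset by blast
  have eq: "{(a, b). a \<in> insert (Suc s) X \<and> b \<in> {1..Suc s} - insert (Suc s) X \<and> a > b} =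
      {(a, b). a \<in> X \<and> b \<in> {1..s} - X \<and> a > b} \<union> Pair (Suc s) ` ({1..s} - X)"
    using assms by auto
  have "finite {(a, b). a \<in> X \<and> b \<in> {1..s} - X \<and> a > b}"
    by (rule finite_subset[of _ "X \<times> {1..s}"]) (use fin in auto)
  moreover have "{(a, b). a \<in> X \<and> b \<in> {1..s} - X \<and> a > b} \<inter> Pair (Suc s) ` ({1..s} - X) = {}"
    using assms by auto
  ultimately show ?thesis
    unfolding cross_inversions_def eq
    using assms fin by (simp add: card_Un_disjoint card_image inj_on_def card_Diff_subset)
qed

lemma gauss_binomial_0 [simp]: "gauss_binomial \<theta> s 0 = 1"
proof -
  have "X \<subseteq> {1..s} \<and> card X = 0 \<longleftrightarrow> X = {}" for X
    using finite_subset[of X "{1..s}"] by auto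
  then show ?thesis
    unfolding gauss_binomial_def by (simp add: cross_inversions_def)
qed

lemma gauss_binomial_eq_0:
  assumes "s < n"
  shows "gauss_binomial \<theta> s n = 0"
proof -
  have "card X \<noteq> n" if "X \<subseteq> {1..s}" for X
    using card_mono[OF _ that] assms by simp
  then have "{X. X \<subseteq> {1..s} \<and> card X = n} = {}" by blast
  then show ?thesis unfolding gauss_binomial_def by (simp only: sum.empty)
qed

text \<open>The Pascal rule: subsets are split by whether they contain s + 1. Truncation of s - n is
  harmless, because for n > s the factor next to the power vanishes.\<close>

lemma gauss_binomial_Suc_Suc:
  "gauss_binomial \<theta> (Suc s) (Suc n) =
     gauss_binomial \<theta> s (Suc n) + \<theta> ^ (s - n) * gauss_binomial \<theta> s n"
proof -
  let ?A = "\<lambda>n. {X. X \<subseteq> {1..s} \<and> card X = n}"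
  have fin: "finite (?A k)" for k by (rule finite_subset[of _ "Pow {1..s}"]) auto
  have finX: "finite X" if "X \<subseteq> {1..s}" for X :: "nat set" using that finite_subset by blast
  have Suc_notin: "Suc s \<notin> X" if "X \<subseteq> {1..s}" for X :: "nat set" using that by auto
  have "{X. X \<subseteq> {1..Suc s} \<and> card X = Suc n} = ?A (Suc n) \<union> insert (Suc s) ` ?A n" (is "?L = ?R")
  proof
    show "?L \<subseteq> ?R"
    proof
      fix X assume X: "X \<in> ?L"
      show "X \<in> ?R"
      proof (cases "Suc s \<in> X")
        case True
        have "X - {Suc s} \<subseteq> {1..s}" using X by (auto simp: atLeastAtMostSuc_conv)
        moreover have "card (X - {Suc s}) = n" using X True by simp
        moreover have "X = insert (Suc s) (X - {Suc s})" using True by auto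
        ultimately show ?thesis by blast
      next
        case False
        then show ?thesis using X by (auto simp: atLeastAtMostSuc_conv)
      qed
    qed
    show "?R \<subseteq> ?L" using finX Suc_notin by (auto simp: card_insert_if)
  qed
  moreover have "?A (Suc n) \<inter> insert (Suc s) ` ?A n = {}" using Suc_notin by blast
  moreover have "inj_on (insert (Suc s)) (?A n)"
    using Suc_notin by (auto simp: inj_on_def dest: insert_ident)
  ultimately have "gauss_binomial \<theta> (Suc s) (Suc n) =
      (\<Sum>X\<in>?A (Suc n). \<theta> ^ cross_inversions (Suc s) X) +
      (\<Sum>X\<in>?A n. \<theta> ^ cross_inversions (Suc s) (insert (Suc s) X))"
    using fin unfolding gauss_binomial_def by (simp add: sum.union_disjoint sum.reindex)
  also have "\<dots> = gauss_binomial \<theta> s (Suc n) +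
      (\<Sum>X\<in>?A n. \<theta> ^ (s - n) * \<theta> ^ cross_inversions s X)"
    unfolding gauss_binomial_def
    by (intro arg_cong2[where f = "(+)"] sum.cong)
      (auto simp: cross_inversions_Suc cross_inversions_insert_Suc power_add)
  finally show ?thesis by (simp add: gauss_binomial_def sum_distrib_left)
qed

lemma P_fact_0 [simp]: "P_fact \<theta> 0 = 1"
  by (simp add: P_fact_def)

lemma P_fact_Suc: "P_fact \<theta> (Suc n) = P_fact \<theta> n * P \<theta> (Suc n)"
  by (simp add: P_fact_def)

lemma P_add: "P \<theta> (m + n) = P \<theta> m + \<theta> ^ m * P \<theta> n"
  by (induction n) (simp_all add: P_def power_add algebra_simps)

lemma P_fact_pos:
  assumes "\<theta> > 0"
  shows "P_fact \<theta> n > 0"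
  unfolding P_fact_def P_def using assms
  by (intro prod_pos ballI sum_pos) (auto simp: lessThan_empty_iff)

text \<open>The product formula, cleared of denominators. After the Pascal rule and the induction
  hypothesis both summands contain \<open>P_fact \<theta> s\<close>, and \<open>P_add\<close>
  combines their cofactors into \<open>P \<theta> (Suc s)\<close>.\<close>

lemma gauss_binomial_fact:
  "n \<le> s \<Longrightarrow> gauss_binomial \<theta> s n * P_fact \<theta> n * P_fact \<theta> (s - n) = P_fact \<theta> s"
proof (induction s arbitrary: n)
  case 0
  then show ?case by simp
next
  case (Suc s n)
  show ?case
  proof (cases n)
    case 0
    then show ?thesis by simp
  next
    case n: (Suc k)
    show ?thesis
    proof (cases "k = s")
      \<comment> \<open>Here k + 1 exceeds s, outside the range of the induction hypothesis, but the
        first Pascal summand is zero.\<close>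
      case True
      have "gauss_binomial \<theta> s s * P_fact \<theta> s = P_fact \<theta> s" using Suc.IH[of s] by simp
      then show ?thesis
        unfolding n True by (auto simp: gauss_binomial_Suc_Suc gauss_binomial_eq_0 P_fact_Suc)
    next
      case False
      \<comment> \<open>The witness d is s - n; naming it replaces all truncated differences by
        sums.\<close>
      then obtain d where s: "s = Suc (k + d)"
        using Suc.prems n by (metis Suc_le_mono le_neq_implies_less less_imp_Suc_add)
      have 1: "gauss_binomial \<theta> s (Suc k) * P_fact \<theta> (Suc k) * P_fact \<theta> d = P_fact \<theta> s"
        using Suc.IH[of "Suc k"] s by simp
      have 2: "gauss_binomial \<theta> s k * P_fact \<theta> k * P_fact \<theta> (Suc d) = P_fact \<theta> s"
        using Suc.IH[of k] s by (simp add: Suc_diff_le)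
      have diffs: "Suc s - n = Suc d" "s - k = Suc d" using s n by auto
      have "gauss_binomial \<theta> (Suc s) n * P_fact \<theta> n * P_fact \<theta> (Suc s - n) =
          (gauss_binomial \<theta> s (Suc k) * P_fact \<theta> (Suc k) * P_fact \<theta> d) * P \<theta> (Suc d) +
          \<theta> ^ Suc d * (gauss_binomial \<theta> s k * P_fact \<theta> k * P_fact \<theta> (Suc d)) * P \<theta> (Suc k)"
        unfolding n diffs[unfolded n] gauss_binomial_Suc_Suc diffs(2)
        by (simp add: P_fact_Suc algebra_simps)
      also have "\<dots> = P_fact \<theta> s * (P \<theta> (Suc d) + \<theta> ^ Suc d * P \<theta> (Suc k))"
        unfolding 1 2 by (simp add: algebra_simps)
      also have "\<dots> = P_fact \<theta> (Suc s)"
        unfolding P_add[symmetric] P_fact_Suc s by (simp add: add.commute)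
      finally show ?thesis .
    qed
  qed
qed

lemma B_fact: "B \<theta> n m * P_fact \<theta> n * P_fact \<theta> m = P_fact \<theta> (n + m)"
  using gauss_binomial_fact[of n "n + m" \<theta>] by (simp add: B_eq_gauss_binomial)

section \<open>Prescribing the last value of a permutation\<close>

text \<open>If \<open>\<sigma>\<close> permutes \<open>{1..n}\<close>, then \<open>raise_cycle n v \<circ> \<sigma>\<close> is the permutation of \<open>{1..Suc n}\<close>
  with last value \<open>v\<close> whose first \<open>n\<close> entries have the relative order of \<open>\<sigma>\<close>.\<close>

definition raise_cycle :: "nat \<Rightarrow> nat \<Rightarrow> nat \<Rightarrow> nat" where
  "raise_cycle n v j = (if j = Suc n then v else if v \<le> j \<and> j \<le> n then Suc j else j)"

lemma raise_cycle_last [simp]: "raise_cycle n v (Suc n) = v"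
  by (simp add: raise_cycle_def)

lemma raise_cycle_id [simp]: "raise_cycle n (Suc n) = id"
  by (auto simp: raise_cycle_def)

lemma raise_cycle_less_iff [simp]:
  assumes "a \<le> n" "b \<le> n"
  shows "raise_cycle n v a < raise_cycle n v b \<longleftrightarrow> a < b"
  using assms by (auto simp: raise_cycle_def)

lemma raise_cycle_permutes:
  assumes "v \<in> {1..Suc n}"
  shows "raise_cycle n v permutes {1..Suc n}"
proof (rule bij_imp_permutes)
  have "inj_on (raise_cycle n v) {1..Suc n}"
    by (auto simp: inj_on_def raise_cycle_def split: if_splits)
  moreover have "raise_cycle n v ` {1..Suc n} \<subseteq> {1..Suc n}"
    using assms by (auto simp: raise_cycle_def)
  ultimately show "bij_betw (raise_cycle n v) {1..Suc n} {1..Suc n}"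
    by (simp add: bij_betw_def endo_inj_surj)
  show "raise_cycle n v x = x" if "x \<notin> {1..Suc n}" for x
    using that assms by (auto simp: raise_cycle_def)
qed

lemma bij_betw_raise_cycle:
  "bij_betw (\<lambda>(v, \<sigma>). raise_cycle n v \<circ> \<sigma>)
     ({1..Suc n} \<times> {\<sigma>. \<sigma> permutes {1..n}}) {p. p permutes {1..Suc n}}" (is "bij_betw ?f ?A ?C")
proof -
  have inj: "inj_on ?f ?A"
  proof (rule inj_onI, clarify)
    fix v \<sigma> w \<tau>
    assume v: "v \<in> {1..Suc n}" and \<sigma>: "\<sigma> permutes {1..n}" and \<tau>: "\<tau> permutes {1..n}"
      and eq: "raise_cycle n v \<circ> \<sigma> = raise_cycle n w \<circ> \<tau>"
    have "\<sigma> (Suc n) = Suc n" "\<tau> (Suc n) = Suc n"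
      using \<sigma> \<tau> by (auto simp: permutes_def)
    \<comment> \<open>The last entry reveals v, since both inner permutations fix n + 1.\<close>
    with eq have vw: "v = w" by (metis comp_apply raise_cycle_last)
    have "inj (raise_cycle n v)" using raise_cycle_permutes[OF v] by (rule permutes_inj)
    with eq vw show "v = w \<and> \<sigma> = \<tau>" by (metis fun.inj_map injD)
  qed
  have "?f ` ?A \<subseteq> ?C"
  proof clarify
    fix v \<sigma> assume v: "v \<in> {1..Suc n}" and \<sigma>: "\<sigma> permutes {1..n}"
    have "\<sigma> permutes {1..Suc n}" using \<sigma> by (rule permutes_subset) auto
    then show "raise_cycle n v \<circ> \<sigma> permutes {1..Suc n}"
      using raise_cycle_permutes[OF v] by (rule permutes_compose)
  qed
  \<comment> \<open>Surjectivity comes from counting: (n + 1) n! = (n + 1)!.\<close>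
  moreover have "card (?f ` ?A) = card ?C"
    using card_image[OF inj] by (simp add: card_cartesian_product card_permutations)
  moreover have "finite ?C" by (simp add: finite_permutations)
  ultimately have "?f ` ?A = ?C" by (metis card_subset_eq)
  with inj show ?thesis by (simp add: bij_betw_def)
qed

lemma permutes_le:
  fixes \<sigma> :: "nat \<Rightarrow> nat"
  assumes "\<sigma> permutes {1..n}" "i \<le> n"
  shows "\<sigma> i \<le> n"
  using assms permutes_in_image[OF assms(1), of i] permutes_not_in[OF assms(1), of i] by fastforce

text \<open>Pairs among the first n positions keep their order; the last entry v forms an inversion
  with each of the n + 1 - v larger values.\<close>

lemma inversions_raise_cycle:
  assumes \<sigma>: "\<sigma> permutes {1..n}" and v: "v \<in> {1..Suc n}"
  shows "inversions (Suc n) (raise_cycle n v \<circ> \<sigma>) = inversions n \<sigma> + (Suc n - v)"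
proof -
  let ?p = "raise_cycle n v \<circ> \<sigma>"
  let ?A = "{(i, j). 1 \<le> i \<and> i < j \<and> j \<le> n \<and> \<sigma> i > \<sigma> j}"
  let ?K = "{i. i \<in> {1..n} \<and> v \<le> \<sigma> i}"
  have last: "?p (Suc n) = v" using \<sigma> by (simp add: permutes_not_in)
  have lt: "?p j < ?p i \<longleftrightarrow> \<sigma> j < \<sigma> i" if "i \<le> n" "j \<le> n" for i j
    using that permutes_le[OF \<sigma>] by simp
  \<comment> \<open>The strict inequality becomes weak because \<open>raise_cycle\<close> lifts the
    value v to v + 1.\<close>
  have gt: "v < ?p i \<longleftrightarrow> v \<le> \<sigma> i" if "i \<le> n" for i
    using permutes_le[OF \<sigma> that] by (auto simp: raise_cycle_def)
  have "(i, j) \<in> {(i, j). 1 \<le> i \<and> i < j \<and> j \<le> Suc n \<and> ?p i > ?p j}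
      \<longleftrightarrow> (i, j) \<in> ?A \<union> (\<lambda>i. (i, Suc n)) ` ?K" for i j
  proof (cases "j = Suc n")
    case True
    then show ?thesis using last gt[of i] by (auto simp del: comp_apply)
  next
    case False
    then show ?thesis using lt[of i j] by (auto simp del: comp_apply)
  qed
  then have eq: "{(i, j). 1 \<le> i \<and> i < j \<and> j \<le> Suc n \<and> ?p i > ?p j} =
      ?A \<union> (\<lambda>i. (i, Suc n)) ` ?K"
    unfolding set_eq_iff split_paired_All by (intro allI)
  have "\<sigma> ` ?K = {v..n}"
  proof -
    have "\<sigma> ` {1..n} = {1..n}" using \<sigma> by (rule permutes_image)
    moreover have "\<sigma> ` ?K = \<sigma> ` {1..n} \<inter> {v..}" by auto
    ultimately show ?thesis using v by auto
  qed
  moreover have "inj_on \<sigma> ?K" using \<sigma> by (rule permutes_inj_on)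
  ultimately have "card ?K = Suc n - v" using card_image[of \<sigma> ?K] by simp
  moreover have "finite ?A" by (rule finite_subset[of _ "{1..n} \<times> {1..n}"]) auto
  moreover have "?A \<inter> (\<lambda>i. (i, Suc n)) ` ?K = {}" by auto
  ultimately show ?thesis
    unfolding inversions_def eq by (simp add: card_Un_disjoint card_image inj_on_def)
qed

text \<open>The source of all recursions below. The predicate Q is arbitrary so that the lemma
  serves both the winnable permutations and \<open>max_first\<close>.\<close>

lemma sum_permutations_Suc:
  "(\<Sum>p \<in> {p. p permutes {1..Suc n} \<and> Q p}. \<theta> ^ inversions (Suc n) p) =
   (\<Sum>v = 1..Suc n. \<theta> ^ (Suc n - v) *
      (\<Sum>\<sigma> \<in> {\<sigma>. \<sigma> permutes {1..n} \<and> Q (raise_cycle n v \<circ> \<sigma>)}. (\<theta>::real) ^ inversions n \<sigma>))"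
proof -
  let ?S = "\<lambda>n. {p. p permutes {1..n::nat}}"
  let ?g = "\<lambda>p. if Q p then \<theta> ^ inversions (Suc n) p else 0"
  have fin: "finite (?S m)" for m by (simp add: finite_permutations)
  \<comment> \<open>Conditions are turned into indicators, so that the bijection can act on the full
    set of permutations.\<close>
  have filter: "(\<Sum>p \<in> {p. p permutes {1..m} \<and> R p}. h p) =
      (\<Sum>p\<in>?S m. if R p then h p else 0)" for m R and h :: "(nat \<Rightarrow> nat) \<Rightarrow> real"
    using sum.inter_filter[OF fin[of m], of h R] by simp
  have "(\<Sum>p \<in> {p. p permutes {1..Suc n} \<and> Q p}. \<theta> ^ inversions (Suc n) p) = sum ?g (?S (Suc n))"
    by (rule filter)
  also have "\<dots> = (\<Sum>(v, \<sigma>)\<in>{1..Suc n} \<times> ?S n. ?g (raise_cycle n v \<circ> \<sigma>))"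
    unfolding sum.reindex_bij_betw[OF bij_betw_raise_cycle, symmetric]
    by (simp only: case_prod_unfold)
  also have "\<dots> = (\<Sum>v = 1..Suc n. \<Sum>\<sigma>\<in>?S n. ?g (raise_cycle n v \<circ> \<sigma>))"
    by (simp add: sum.cartesian_product)
  also have "\<dots> = (\<Sum>v = 1..Suc n. \<Sum>\<sigma>\<in>?S n. if Q (raise_cycle n v \<circ> \<sigma>)
      then \<theta> ^ (Suc n - v) * \<theta> ^ inversions n \<sigma> else 0)"
    by (intro sum.cong refl)
      (simp only: mem_Collect_eq inversions_raise_cycle power_add mult.commute)
  also have "\<dots> = (\<Sum>v = 1..Suc n. \<theta> ^ (Suc n - v) *
      (\<Sum>\<sigma> \<in> {\<sigma>. \<sigma> permutes {1..n} \<and> Q (raise_cycle n v \<circ> \<sigma>)}. \<theta> ^ inversions n \<sigma>))"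
    unfolding sum_distrib_left filter by (intro sum.cong refl) simp
  finally show ?thesis .
qed

section \<open>The selection rule\<close>

text \<open>Eligibility of i depends only on the relative order of the first i entries, and
  \<open>raise_cycle n v\<close> is increasing up to n.\<close>

lemma eligible_raise_cycle:
  assumes "\<sigma> permutes {1..n}" "i \<le> n"
  shows "eligible k1 k2 (raise_cycle n v \<circ> \<sigma>) i \<longleftrightarrow> eligible k1 k2 \<sigma> i"
proof -
  have "(raise_cycle n v \<circ> \<sigma>) j < (raise_cycle n v \<circ> \<sigma>) l \<longleftrightarrow> \<sigma> j < \<sigma> l"
    if "j \<le> i" "l \<le> i" for j l
    using that assms permutes_le[OF assms(1)] by simp
  then have "ltr_max (raise_cycle n v \<circ> \<sigma>) i \<longleftrightarrow> ltr_max \<sigma> i"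
    "ltr_second_max (raise_cycle n v \<circ> \<sigma>) i \<longleftrightarrow> ltr_second_max \<sigma> i"
    unfolding ltr_max_def ltr_second_max_def
    by (auto simp del: comp_apply simp: less_imp_le cong: conj_cong)
  then show ?thesis by (simp add: eligible_def)
qed

lemma pickable2_raise_cycle:
  assumes "\<sigma> permutes {1..n}" "m \<le> n"
  shows "pickable2 m k1 k2 (raise_cycle n v \<circ> \<sigma>) \<longleftrightarrow> pickable2 m k1 k2 \<sigma>"
  using assms by (auto simp: pickable2_def eligible_raise_cycle)

lemma pickable2_eq_pickable1:
  "n \<le> k2 \<Longrightarrow> pickable2 n k1 k2 p \<longleftrightarrow> pickable1 n k1 p"
  by (auto simp: pickable2_def pickable1_def eligible_def)

lemma accepted_eqI:
  assumes "i \<in> {1..n}" "eligible k1 k2 p i" "\<not> pickable2 (i - 1) k1 k2 p"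
  shows "accepted n k1 k2 p = i"
proof -
  have "pickable2 n k1 k2 p" using assms by (auto simp: pickable2_def)
  moreover have "(LEAST i. i \<in> {1..n} \<and> eligible k1 k2 p i) = i"
  proof (rule Least_equality)
    fix j assume j: "j \<in> {1..n} \<and> eligible k1 k2 p j"
    show "i \<le> j"
    proof (rule ccontr)
      assume "\<not> i \<le> j"
      then have "j \<in> {1..i - 1}" using j by auto
      then show False using j assms(3) by (auto simp: pickable2_def)
    qed
  qed (use assms in auto)
  ultimately show ?thesis by (simp add: accepted_def)
qed

text \<open>The last position is chosen either as the first eligible one or by default.\<close>

lemma accepted_not_pickable2:
  assumes "\<not> pickable2 n k1 k2 p"
  shows "accepted (Suc n) k1 k2 p = Suc n"
proof (cases "eligible k1 k2 p (Suc n)")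
  case True
  then show ?thesis using assms by (intro accepted_eqI) auto
next
  case False
  then have "\<not> pickable2 (Suc n) k1 k2 p"
    using assms by (auto simp: pickable2_def atLeastAtMostSuc_conv)
  then show ?thesis by (simp add: accepted_def)
qed

lemma pickable2_first_eligible:
  assumes "pickable2 n k1 k2 p"
  obtains i where "i \<in> {1..n}" "eligible k1 k2 p i" "\<not> pickable2 (i - 1) k1 k2 p"
proof -
  have "\<exists>i. i \<in> {1..n} \<and> eligible k1 k2 p i" using assms by (auto simp: pickable2_def)
  then obtain i where i: "i \<in> {1..n}" "eligible k1 k2 p i"
    and least: "\<And>j. j < i \<Longrightarrow> \<not> (j \<in> {1..n} \<and> eligible k1 k2 p j)"
    unfolding exists_least_iff[of "\<lambda>i. i \<in> {1..n} \<and> eligible k1 k2 p i"] by blast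
  have "\<not> eligible k1 k2 p j" if "j \<in> {1..i - 1}" for j
  proof -
    have "j < i" "j \<in> {1..n}" using that i(1) by auto
    then show ?thesis using least by blast
  qed
  then have "\<not> pickable2 (i - 1) k1 k2 p" by (auto simp: pickable2_def)
  with i that show ?thesis by blast
qed

text \<open>The maximum is always a left-to-right maximum and never a second maximum, so only the
  threshold k1 counts.\<close>

lemma eligible_at_max:
  assumes "p permutes {1..n}" "i \<in> {1..n}" "p i = n"
  shows "eligible k1 k2 p i \<longleftrightarrow> k1 < i"
proof -
  have less: "p j < p i" if "j \<in> {1..<i}" for j
  proof -
    have "p j \<noteq> p i" using that inj_eq[OF permutes_inj[OF assms(1)]] by simp
    then show ?thesis using permutes_le[OF assms(1), of j] that assms(2,3) by simp
  qed
  then have "ltr_max p i" by (simp add: ltr_max_def)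
  moreover have "\<not> ltr_second_max p i"
    unfolding ltr_second_max_def using less by (meson order.asym)
  ultimately show ?thesis by (simp add: eligible_def)
qed

text \<open>The value \<open>n - 1\<close> at the last position \<open>n > k2\<close> makes that position a left-to-right second
  maximum, so the default choice of the last position never wins.\<close>

lemma winnable_pickable2:
  assumes \<sigma>: "\<sigma> permutes {1..n}" and "k2 < n" and win: "winnable n k1 k2 \<sigma>"
  shows "pickable2 n k1 k2 \<sigma>"
proof (rule ccontr)
  assume np: "\<not> pickable2 n k1 k2 \<sigma>"
  then have last: "Suc (\<sigma> n) = n" using win by (simp add: winnable_def accepted_def)
  have "n \<in> \<sigma> ` {1..n}" using permutes_image[OF \<sigma>] \<open>k2 < n\<close> by simp
  then obtain j where j: "j \<in> {1..n}" "\<sigma> j = n" by auto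
  then have "j < n" using last by (cases "j = n") auto
  have "l = j" if "\<sigma> n < \<sigma> l" "l \<le> n" for l
  proof -
    have "\<sigma> l = \<sigma> j" using that last permutes_le[OF \<sigma>, of l] j(2) by linarith
    then show ?thesis using inj_eq[OF permutes_inj[OF \<sigma>]] by simp
  qed
  then have "ltr_second_max \<sigma> n"
    unfolding ltr_second_max_def using j last \<open>j < n\<close> by (intro ex1I[of _ j]) auto
  then have "eligible k1 k2 \<sigma> n" using \<open>k2 < n\<close> by (simp add: eligible_def)
  then show False using np \<open>k2 < n\<close> by (auto simp: pickable2_def)
qed

text \<open>If some position is eligible, the same one is accepted on both sides. Otherwise both
  sides are false: the left because the last value v is not n, the right by
  \<open>winnable_pickable2\<close>.\<close>

lemma winnable_raise_cycle_less:
  assumes \<sigma>: "\<sigma> permutes {1..n}" and "k2 < n" and "v < n"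
  shows "winnable (Suc n) k1 k2 (raise_cycle n v \<circ> \<sigma>) \<longleftrightarrow> winnable n k1 k2 \<sigma>"
proof (cases "pickable2 n k1 k2 \<sigma>")
  case True
  then obtain i where i: "i \<in> {1..n}" "eligible k1 k2 \<sigma> i" "\<not> pickable2 (i - 1) k1 k2 \<sigma>"
    by (rule pickable2_first_eligible)
  have "accepted n k1 k2 \<sigma> = i" using i by (rule accepted_eqI)
  moreover have "accepted (Suc n) k1 k2 (raise_cycle n v \<circ> \<sigma>) = i"
    using i \<sigma> by (intro accepted_eqI) (auto simp: eligible_raise_cycle pickable2_raise_cycle)
  \<comment> \<open>Since v is at most n - 1, the old winning value n - 1 is lifted to the new
    winning value n, and n to n + 1.\<close>
  moreover have "raise_cycle n v (\<sigma> i) = n \<longleftrightarrow> Suc (\<sigma> i) = n"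
    using permutes_le[OF \<sigma>, of i] i(1) \<open>v < n\<close> by (auto simp: raise_cycle_def)
  ultimately show ?thesis by (simp add: winnable_def)
next
  case False
  then have "accepted (Suc n) k1 k2 (raise_cycle n v \<circ> \<sigma>) = Suc n"
    using \<sigma> by (intro accepted_not_pickable2) (simp add: pickable2_raise_cycle)
  then have "\<not> winnable (Suc n) k1 k2 (raise_cycle n v \<circ> \<sigma>)"
    using \<sigma> \<open>v < n\<close> by (simp add: winnable_def permutes_not_in)
  then show ?thesis using False winnable_pickable2[OF \<sigma> \<open>k2 < n\<close>] by blast
qed

text \<open>The winning value n stands at the last position, which is accepted exactly when no
  earlier position is eligible.\<close>

lemma winnable_raise_cycle_eq:
  assumes \<sigma>: "\<sigma> permutes {1..n}"
  shows "winnable (Suc n) k1 k2 (raise_cycle n n \<circ> \<sigma>) \<longleftrightarrow> \<not> pickable2 n k1 k2 \<sigma>"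
proof (cases "pickable2 n k1 k2 \<sigma>")
  case True
  then obtain i where i: "i \<in> {1..n}" "eligible k1 k2 \<sigma> i" "\<not> pickable2 (i - 1) k1 k2 \<sigma>"
    by (rule pickable2_first_eligible)
  have "accepted (Suc n) k1 k2 (raise_cycle n n \<circ> \<sigma>) = i"
    using i \<sigma> by (intro accepted_eqI) (auto simp: eligible_raise_cycle pickable2_raise_cycle)
  moreover have "raise_cycle n n (\<sigma> i) \<noteq> n"
    using permutes_le[OF \<sigma>, of i] i(1) by (auto simp: raise_cycle_def)
  ultimately show ?thesis using True by (simp add: winnable_def)
next
  case False
  then have "accepted (Suc n) k1 k2 (raise_cycle n n \<circ> \<sigma>) = Suc n"
    using \<sigma> by (intro accepted_not_pickable2) (simp add: pickable2_raise_cycle)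
  then show ?thesis using False \<sigma> by (simp add: winnable_def permutes_not_in)
qed

text \<open>The case of last value n + 1, where \<open>raise_cycle\<close> is the identity. The
  winning value n is the maximum of the first n entries, so its position is eligible iff it exceeds
  k1, and it is accepted iff nothing earlier is eligible.\<close>

lemma winnable_Suc_iff:
  assumes \<sigma>: "\<sigma> permutes {1..n}"
  shows "winnable (Suc n) k1 k2 \<sigma> \<longleftrightarrow>
    (\<exists>i\<in>{k1 + 1..n}. \<sigma> i = n \<and> \<not> pickable2 (i - 1) k1 k2 \<sigma>)"
proof
  assume win: "winnable (Suc n) k1 k2 \<sigma>"
  have "pickable2 n k1 k2 \<sigma>"
  proof (rule ccontr)
    assume "\<not> pickable2 n k1 k2 \<sigma>"
    then have "\<sigma> (Suc n) = n" using win by (simp add: accepted_not_pickable2 winnable_def)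
    then show False using \<sigma> by (simp add: permutes_not_in)
  qed
  then obtain i where i: "i \<in> {1..n}" "eligible k1 k2 \<sigma> i" "\<not> pickable2 (i - 1) k1 k2 \<sigma>"
    by (rule pickable2_first_eligible)
  then have "accepted (Suc n) k1 k2 \<sigma> = i" by (intro accepted_eqI) auto
  then have "\<sigma> i = n" using win by (simp add: winnable_def)
  moreover from this have "k1 < i" using i eligible_at_max[OF \<sigma>] by blast
  ultimately show "\<exists>i\<in>{k1 + 1..n}. \<sigma> i = n \<and> \<not> pickable2 (i - 1) k1 k2 \<sigma>"
    using i by auto
next
  assume "\<exists>i\<in>{k1 + 1..n}. \<sigma> i = n \<and> \<not> pickable2 (i - 1) k1 k2 \<sigma>"
  then obtain i where i: "i \<in> {1..n}" "k1 < i" "\<sigma> i = n" "\<not> pickable2 (i - 1) k1 k2 \<sigma>"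
    by auto
  then have "accepted (Suc n) k1 k2 \<sigma> = i"
    using eligible_at_max[OF \<sigma>] by (intro accepted_eqI) auto
  then show "winnable (Suc n) k1 k2 \<sigma>" using i by (simp add: winnable_def)
qed

section \<open>Permutations with no eligible position before the maximum\<close>

text \<open>Serves the case of last value N, with n = N - 1: the winning value N - 1 is then the
  maximum of the remaining entries, and i is its position.\<close>

definition max_first :: "real \<Rightarrow> nat \<Rightarrow> nat \<Rightarrow> nat \<Rightarrow> nat \<Rightarrow> real" where
  "max_first \<theta> n k1 k2 i =
     (\<Sum>p \<in> {p. p permutes {1..n} \<and> p i = n \<and> \<not> pickable2 (i - 1) k1 k2 p}. \<theta> ^ inversions n p)"

lemma max_first_diag: "max_first \<theta> (Suc m) k1 k2 (Suc m) = T1_two \<theta> m k1 k2"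
proof -
  let ?Q = "\<lambda>p. p (Suc m) = Suc m \<and> \<not> pickable2 m k1 k2 p"
  have "(\<Sum>\<sigma> \<in> {\<sigma>. \<sigma> permutes {1..m} \<and> ?Q (raise_cycle m v \<circ> \<sigma>)}. \<theta> ^ inversions m \<sigma>) =
      (if v = Suc m then T1_two \<theta> m k1 k2 else 0)" for v
  proof -
    have "{\<sigma>. \<sigma> permutes {1..m} \<and> ?Q (raise_cycle m v \<circ> \<sigma>)} =
        (if v = Suc m then {\<sigma>. \<sigma> permutes {1..m} \<and> \<not> pickable2 m k1 k2 \<sigma>} else {})"
      by (auto simp: permutes_not_in)
    then show ?thesis by (simp add: T1_two_def)
  qed
  then show ?thesis
    unfolding max_first_def diff_Suc_1 sum_permutations_Suc[where Q = ?Q] by simp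
qed

text \<open>The maximum stays at i, so the last value v ranges over 1 to n, and the weights
  \<open>\<theta> ^ (Suc n - v)\<close> add up to \<open>\<theta> * P \<theta> n\<close>.\<close>

lemma max_first_Suc:
  assumes "i \<in> {1..n}"
  shows "max_first \<theta> (Suc n) k1 k2 i = \<theta> * P \<theta> n * max_first \<theta> n k1 k2 i"
proof -
  let ?Q = "\<lambda>p. p i = Suc n \<and> \<not> pickable2 (i - 1) k1 k2 p"
  have "(\<Sum>\<sigma> \<in> {\<sigma>. \<sigma> permutes {1..n} \<and> ?Q (raise_cycle n v \<circ> \<sigma>)}. \<theta> ^ inversions n \<sigma>) =
      (if v = Suc n then 0 else max_first \<theta> n k1 k2 i)" if v: "v \<in> {1..Suc n}" for v
  proof -
    have "?Q (raise_cycle n v \<circ> \<sigma>) \<longleftrightarrow> v \<noteq> Suc n \<and> \<sigma> i = n \<and> \<not> pickable2 (i - 1) k1 k2 \<sigma>"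
      if \<sigma>: "\<sigma> permutes {1..n}" for \<sigma>
    proof -
      \<comment> \<open>For v up to n the value n is lifted to n + 1; for v = n + 1 nothing is
        lifted and the first n entries stay below n + 1.\<close>
      have "raise_cycle n v (\<sigma> i) = Suc n \<longleftrightarrow> v \<noteq> Suc n \<and> \<sigma> i = n"
        using permutes_le[OF \<sigma>, of i] assms v by (auto simp: raise_cycle_def)
      moreover have "i - 1 \<le> n" using assms by auto
      ultimately show ?thesis using pickable2_raise_cycle[OF \<sigma>] by auto
    qed
    then have "{\<sigma>. \<sigma> permutes {1..n} \<and> ?Q (raise_cycle n v \<circ> \<sigma>)} = (if v = Suc n then {}
        else {\<sigma>. \<sigma> permutes {1..n} \<and> \<sigma> i = n \<and> \<not> pickable2 (i - 1) k1 k2 \<sigma>})" by auto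
    then show ?thesis by (simp only: max_first_def sum.empty split: if_split) simp
  qed
  then have "max_first \<theta> (Suc n) k1 k2 i =
      (\<Sum>v = 1..Suc n. \<theta> ^ (Suc n - v) * (if v = Suc n then 0 else max_first \<theta> n k1 k2 i))"
    unfolding max_first_def[of _ "Suc n"] sum_permutations_Suc[where Q = ?Q]
    by (intro sum.cong refl) simp
  also have "\<dots> = (\<Sum>v = 1..n. \<theta> ^ (Suc n - v)) * max_first \<theta> n k1 k2 i"
    by (simp add: sum_distrib_right)
  also have "(\<Sum>v = 1..n. \<theta> ^ (Suc n - v)) = \<theta> * P \<theta> n"
    unfolding P_def sum_distrib_left
    by (rule sum.reindex_bij_witness[where i = "\<lambda>j. n - j" and j = "\<lambda>v. n - v"])
      (auto simp: Suc_diff_le)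
  finally show ?thesis .
qed

text \<open>Starting from the maximum in last place, d steps collect \<open>\<theta> ^ d\<close> and
  the factors P of m + 1 to m + d. The factor \<open>P_fact \<theta> m\<close> on the left avoids a
  quotient.\<close>

lemma max_first_fact:
  "max_first \<theta> (Suc m + d) k1 k2 (Suc m) * P_fact \<theta> m =
     \<theta> ^ d * T1_two \<theta> m k1 k2 * P_fact \<theta> (m + d)"
proof (induction d)
  case 0
  then show ?case by (simp add: max_first_diag)
next
  case (Suc d)
  have "max_first \<theta> (Suc m + Suc d) k1 k2 (Suc m) =
      \<theta> * P \<theta> (Suc m + d) * max_first \<theta> (Suc m + d) k1 k2 (Suc m)"
    using max_first_Suc[of "Suc m" "Suc m + d"] by simp
  then show ?case using Suc by (simp add: P_fact_Suc)
qed

text \<open>\<open>B_fact\<close> rewrites the quotient of factorials; positivity of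
  \<open>\<theta>\<close> allows cancelling \<open>P_fact \<theta> (i - 1)\<close>.\<close>

lemma max_first_eq:
  assumes "\<theta> > 0" "i \<in> {1..n}"
  shows "max_first \<theta> n k1 k2 i =
    \<theta> ^ (n - i) * T1_two \<theta> (i - 1) k1 k2 * B \<theta> (i - 1) (n - i) * P_fact \<theta> (n - i)"
proof -
  have "Suc (i - 1) = i" "Suc (i - 1) + (n - i) = n" using assms by auto
  then have "max_first \<theta> n k1 k2 i * P_fact \<theta> (i - 1) =
      \<theta> ^ (n - i) * T1_two \<theta> (i - 1) k1 k2 * P_fact \<theta> (i - 1 + (n - i))"
    using max_first_fact[of \<theta> "i - 1" "n - i"] by simp
  also have "\<dots> = (\<theta> ^ (n - i) * T1_two \<theta> (i - 1) k1 k2 * B \<theta> (i - 1) (n - i) *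
      P_fact \<theta> (n - i)) * P_fact \<theta> (i - 1)"
    unfolding B_fact[symmetric] by simp
  finally show ?thesis using P_fact_pos[OF assms(1), of "i - 1"] by simp
qed

lemma sum_winnable_Suc:
  "(\<Sum>\<sigma> \<in> {\<sigma>. \<sigma> permutes {1..n} \<and> winnable (Suc n) k1 k2 \<sigma>}. \<theta> ^ inversions n \<sigma>) =
   (\<Sum>i = k1 + 1..n. max_first \<theta> n k1 k2 i)"
proof -
  let ?A = "\<lambda>i. {p. p permutes {1..n} \<and> p i = n \<and> \<not> pickable2 (i - 1) k1 k2 p}"
  have UN: "{\<sigma>. \<sigma> permutes {1..n} \<and> winnable (Suc n) k1 k2 \<sigma>} = (\<Union>i\<in>{k1 + 1..n}. ?A i)"
    (is "?L = ?R")
  proof (rule set_eqI)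
    show "\<sigma> \<in> ?L \<longleftrightarrow> \<sigma> \<in> ?R" for \<sigma>
      using winnable_Suc_iff[of \<sigma> n k1 k2] by blast
  qed
  have "finite (?A i)" for i
    by (rule finite_subset[of _ "{p. p permutes {1..n}}"]) (auto simp: finite_permutations)
  moreover have "?A i \<inter> ?A j = {}" if "i \<noteq> j" for i j
  proof -
    have "p \<notin> ?A i \<inter> ?A j" for p
    proof
      assume "p \<in> ?A i \<inter> ?A j"
      then have p: "p permutes {1..n}" and eq: "p i = p j" by simp_all
      from permutes_inj[OF p] eq have "i = j" by (rule injD)
      with that show False by contradiction
    qed
    then show ?thesis by blast
  qed
  ultimately show ?thesis
    unfolding max_first_def UN by (intro sum.UNION_disjoint) blast+
qed

section \<open>The recursion\<close>

lemma T1_two_eq_T1_one: "n \<le> k2 \<Longrightarrow> T1_two \<theta> n k1 k2 = T1_one \<theta> n k1"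
  by (simp add: T1_two_def T1_one_def pickable2_eq_pickable1)

theorem theorem13:
  fixes \<theta> :: real and N k1 k2 :: nat
  assumes "\<theta> > 0" and "k1 \<le> k2" and "k2 + 2 \<le> N"
  shows "W1 \<theta> N k1 k2 =
      \<theta>\<^sup>2 * P \<theta> (N - 2) * W1 \<theta> (N - 1) k1 k2
    + \<theta> * T1_two \<theta> (N - 1) k1 k2
    + (\<Sum>i = k1 + 1..k2 + 1.
         \<theta> ^ (N - i - 1) * T1_one \<theta> (i - 1) k1 * B \<theta> (i - 1) (N - i - 1) * P_fact \<theta> (N - i - 1))
    + (\<Sum>i = k2 + 2..N - 1.
         \<theta> ^ (N - i - 1) * T1_two \<theta> (i - 1) k1 k2 * B \<theta> (i - 1) (N - i - 1) * P_fact \<theta> (N - i - 1))"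
proof -
  \<comment> \<open>With N = m + 2 the last value v splits into 1 to m, m + 1 = N - 1 and m + 2 =
    N.\<close>
  obtain m where N: "N = Suc (Suc m)" using assms(3) by (metis add_2_eq_Suc' le_Suc_ex add_Suc)
  have k2: "k2 < Suc m" using assms(3) N by simp
  let ?S = "\<lambda>v. \<Sum>\<sigma> \<in> {\<sigma>. \<sigma> permutes {1..Suc m} \<and>
      winnable (Suc (Suc m)) k1 k2 (raise_cycle (Suc m) v \<circ> \<sigma>)}. \<theta> ^ inversions (Suc m) \<sigma>"
  let ?t = "\<lambda>i. \<theta> ^ (N - i - 1) * T1_two \<theta> (i - 1) k1 k2 * B \<theta> (i - 1) (N - i - 1) *
      P_fact \<theta> (N - i - 1)"
  have "?S v = W1 \<theta> (Suc m) k1 k2" if "v \<in> {1..m}" for v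
    unfolding W1_def using that k2
    by (intro sum.cong refl Collect_cong) (auto simp: winnable_raise_cycle_less)
  then have "(\<Sum>v = 1..m. \<theta> ^ (Suc (Suc m) - v) * ?S v) =
      (\<Sum>v = 1..m. \<theta> ^ (Suc (Suc m) - v)) * W1 \<theta> (Suc m) k1 k2"
    by (simp add: sum_distrib_right)
  \<comment> \<open>The exponents run from 2 to m + 1, which explains the square of
    \<open>\<theta>\<close>.\<close>
  also have "(\<Sum>v = 1..m. \<theta> ^ (Suc (Suc m) - v)) = \<theta>\<^sup>2 * P \<theta> m"
    unfolding P_def sum_distrib_left
    by (rule sum.reindex_bij_witness[where i = "\<lambda>j. m - j" and j = "\<lambda>v. m - v"])
      (auto simp: Suc_diff_le power2_eq_square)
  finally have low: "(\<Sum>v = 1..m. \<theta> ^ (Suc (Suc m) - v) * ?S v) =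
      \<theta>\<^sup>2 * P \<theta> m * W1 \<theta> (Suc m) k1 k2" .
  have mid: "?S (Suc m) = T1_two \<theta> (Suc m) k1 k2"
    unfolding T1_two_def
    by (intro sum.cong refl Collect_cong) (auto simp: winnable_raise_cycle_eq)
  have "?S (Suc (Suc m)) = (\<Sum>i = k1 + 1..Suc m. max_first \<theta> (Suc m) k1 k2 i)"
    using sum_winnable_Suc by simp
  also have "\<dots> = sum ?t {k1 + 1..Suc m}"
    using assms(1) N by (intro sum.cong refl) (auto simp: max_first_eq)
  \<comment> \<open>Up to i = k2 + 1 the prefix of length i - 1 does not pass k2, so no second
    maximum in it can be eligible and \<open>T1_two\<close> equals \<open>T1_one\<close>.\<close>
  also have "{k1 + 1..Suc m} = {k1 + 1..k2 + 1} \<union> {k2 + 2..Suc m}"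
    using assms(2) k2 by auto
  also have "sum ?t \<dots> = sum ?t {k1 + 1..k2 + 1} + sum ?t {k2 + 2..Suc m}"
    by (rule sum.union_disjoint) auto
  also have "sum ?t {k1 + 1..k2 + 1} = (\<Sum>i = k1 + 1..k2 + 1. \<theta> ^ (N - i - 1) *
      T1_one \<theta> (i - 1) k1 * B \<theta> (i - 1) (N - i - 1) * P_fact \<theta> (N - i - 1))"
    by (intro sum.cong refl) (auto simp: T1_two_eq_T1_one le_diff_conv)
  \<comment> \<open>The dots stand for the sum with \<open>T1_one\<close> obtained in the preceding
    step.\<close>
  finally have high: "?S (Suc (Suc m)) = \<dots> + sum ?t {k2 + 2..Suc m}" .
  have "W1 \<theta> N k1 k2 = (\<Sum>v = 1..Suc (Suc m). \<theta> ^ (Suc (Suc m) - v) * ?S v)"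
    unfolding W1_def N by (rule sum_permutations_Suc)
  also have "\<dots> = (\<Sum>v = 1..m. \<theta> ^ (Suc (Suc m) - v) * ?S v) + \<theta> * ?S (Suc m) + ?S (Suc (Suc m))"
    by simp
  finally show ?thesis
    unfolding low mid high using N by (simp add: numeral_2_eq_2)
qed

end
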